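(* Let $(B,+,\circ)$ be a near brace and let $z_1,z_2,\xi\in B$ be such that there exist $c_1,c_2\in B$ such that for all $a,b,c\in B$: $(a-b+c)\circ z_i=a\circ z_i-b\circ z_i+c\circ z_i$ for $i\in\{1,2\}$, $a\circ z_2\circ z_1-a\circ\xi=c_1$, and $-a\circ\xi+a\circ z_1\circ z_2=c_2$. Let $\check r:B\times B\to B\times B$, $\check r(x,y)=(\sigma^p_x(y),\tau^p_y(x))$, where $\sigma^p_x(y)=x\circ y\circ z_1-x\circ\xi+z_2$ and $\tau^p_y(x)=\sigma^p_x(y)^{-1}\circ x\circ y$. Then $\check r$ is a $p$-braiding (operator for the group $(B,\circ)$).
   Context: A near brace is a set $B$ with two group operations $+$ and $\circ$ (neither necessarily abelian) such that for all $a,b,c\in B$, $a\circ(b+c)=a\circ b-a\circ 0+a\circ c$, where $0$ is the neutral element of $(B,+)$ and $1$ that of $(B,\circ)$. Here $\circ$ binds more tightly than $+,-$; $-a$ is the inverse in $(B,+)$ and $a^{-1}$ the inverse in $(B,\circ)$. Let $(G,\circ)$ be a group, $m(x,y)=x\circ y$, and let $\check r:G\times G\to G\times G$ be an invertible map, $\check r(x,y)=(\sigma^p_x(y),\tau^p_y(x))$ for all $x,y\in G$, where all $\sigma^p_x,\tau^p_y$ are bijective maps of $G$. Write $\check r_{12}=\check r\times\mathrm{id}$ and $\check r_{23}=\mathrm{id}\times\check r$ on $G\times G\times G$; products of maps denote composition (rightmost applied first). The map $\check r$ is called a $p$-braiding operator ($p$-braiding) if there exist bijections $f^p_x,g^p_x:G\to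 G$, given for all $x\in G$, such that for all $x,y,w\in G$: (1) $x\circ y=\sigma^p_x(y)\circ\tau^p_y(x)$; (2) $(\mathrm{id}\times m)\,\check r_{12}\,\check r_{23}(x,y,w)=(f^p_{x\circ y}(w),\ f^p_{x\circ y}(w)^{-1}\circ x\circ y\circ w)$; (3) $(m\times\mathrm{id})\,\check r_{23}\,\check r_{12}(x,y,w)=(g^p_x(y\circ w),\ g^p_x(y\circ w)^{-1}\circ x\circ y\circ w)$. *)

theory Defs
  imports "HOL-Algebra.Ring"
begin

text \<open>
  The ring record only supplies the two operations: \<open>\<oplus>\<close>, \<open>\<zero>\<close>, \<open>\<ominus>\<close> belong to \<open>(B, +)\<close>, which need not
  be abelian, and \<open>\<otimes>\<close>, \<open>\<one>\<close>, \<open>inv\<close> to \<open>(B, \<circ>)\<close>. No ring axioms are assumed.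
\<close>

locale near_brace = group B + add: group "add_monoid B"
  for B :: "('a, 'b) ring_scheme" (structure) +
  assumes near_distrib:
    "\<lbrakk>a \<in> carrier B; b \<in> carrier B; c \<in> carrier B\<rbrakk>
      \<Longrightarrow> a \<otimes> (b \<oplus> c) = a \<otimes> b \<ominus> a \<otimes> \<zero> \<oplus> a \<otimes> c"

text \<open>Components of \<open>r (x, y) = (\<sigma>\<^sub>x(y), \<tau>\<^sub>y(x))\<close>; note the argument order of the second one.\<close>

definition braid_sigma :: "('a \<times> 'a \<Rightarrow> 'a \<times> 'a) \<Rightarrow> 'a \<Rightarrow> 'a \<Rightarrow> 'a"
  where "braid_sigma r x y = fst (r (x, y))"

definition braid_tau :: "('a \<times> 'a \<Rightarrow> 'a \<times> 'a) \<Rightarrow> 'a \<Rightarrow> 'a \<Rightarrow> 'a"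
  where "braid_tau r y x = snd (r (x, y))"

definition on12 :: "('a \<times> 'a \<Rightarrow> 'a \<times> 'a) \<Rightarrow> 'a \<times> 'a \<times> 'a \<Rightarrow> 'a \<times> 'a \<times> 'a"
  where "on12 r = (\<lambda>(x, y, w). case r (x, y) of (u, v) \<Rightarrow> (u, v, w))"

definition on23 :: "('a \<times> 'a \<Rightarrow> 'a \<times> 'a) \<Rightarrow> 'a \<times> 'a \<times> 'a \<Rightarrow> 'a \<times> 'a \<times> 'a"
  where "on23 r = map_prod id r"

definition id_times_mult :: "('a, 'b) monoid_scheme \<Rightarrow> 'a \<times> 'a \<times> 'a \<Rightarrow> 'a \<times> 'a"
  where "id_times_mult G = (\<lambda>(x, y, w). (x, y \<otimes>\<^bsub>G\<^esub> w))"

definition mult_times_id :: "('a, 'b) monoid_scheme \<Rightarrow> 'a \<times> 'a \<times> 'a \<Rightarrow> 'a \<times> 'a"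
  where "mult_times_id G = (\<lambda>(x, y, w). (x \<otimes>\<^bsub>G\<^esub> y, w))"

text \<open>\<open>r\<close> is a map of \<open>G \<times> G\<close>; its values outside the carrier are irrelevant.\<close>

locale p_braiding = group G for G :: "('a, 'b) monoid_scheme" (structure) +
  fixes r :: "'a \<times> 'a \<Rightarrow> 'a \<times> 'a"
  assumes r_bij: "bij_betw r (carrier G \<times> carrier G) (carrier G \<times> carrier G)"
    and sigma_bij: "x \<in> carrier G \<Longrightarrow> bij_betw (braid_sigma r x) (carrier G) (carrier G)"
    and tau_bij: "y \<in> carrier G \<Longrightarrow> bij_betw (braid_tau r y) (carrier G) (carrier G)"
    and r_mult: "\<lbrakk>x \<in> carrier G; y \<in> carrier G\<rbrakk>
      \<Longrightarrow> x \<otimes> y = braid_sigma r x y \<otimes> braid_tau r y x"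
    and ex_f: "\<exists>f. (\<forall>x\<in>carrier G. bij_betw (f x) (carrier G) (carrier G)) \<and>
      (\<forall>x\<in>carrier G. \<forall>y\<in>carrier G. \<forall>w\<in>carrier G.
        (id_times_mult G \<circ> on12 r \<circ> on23 r) (x, y, w)
          = (f (x \<otimes> y) w, inv (f (x \<otimes> y) w) \<otimes> x \<otimes> y \<otimes> w))"
    and ex_g: "\<exists>g. (\<forall>x\<in>carrier G. bij_betw (g x) (carrier G) (carrier G)) \<and>
      (\<forall>x\<in>carrier G. \<forall>y\<in>carrier G. \<forall>w\<in>carrier G.
        (mult_times_id G \<circ> on23 r \<circ> on12 r) (x, y, w)
          = (g x (y \<otimes> w), inv (g x (y \<otimes> w)) \<otimes> x \<otimes> y \<otimes> w))"

end

theory Submission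
  imports Defs
begin

text \<open>
  In a near brace left multiplications preserve the ternary operation \<open>a - b + c\<close>, and by hypothesis so
  do the right multiplications by \<open>z\<^sub>1\<close> and \<open>z\<^sub>2\<close>. Expanding with these laws, the first component in
  axiom (2) is \<open>x\<circ>y\<circ>w\<circ>z\<^sub>1\<circ>z\<^sub>1 - x\<circ>y\<circ>\<xi>\<circ>z\<^sub>1 + (x\<circ>z\<^sub>2\<circ>z\<^sub>1 - x\<circ>\<xi>) + z\<^sub>2\<close>, whose bracket is the constant \<open>c\<^sub>1\<close>, and
  the one in axiom (3) is \<open>x\<circ>y\<circ>w\<circ>z\<^sub>1 + (-x\<circ>y\<circ>\<xi> + x\<circ>y\<circ>z\<^sub>1\<circ>z\<^sub>2) - x\<circ>\<xi>\<circ>z\<^sub>2 + z\<^sub>2\<circ>z\<^sub>2\<close>, whose bracket is \<open>c\<^sub>2\<close>.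
  The second components are then forced, since \<open>r\<close> preserves products.
\<close>

lemma (in group) l_inv_cancel:
  "\<lbrakk>a \<in> carrier G; b \<in> carrier G\<rbrakk> \<Longrightarrow> inv a \<otimes> (a \<otimes> b) = b"
  by (simp flip: m_assoc)

lemma (in group) r_inv_cancel:
  "\<lbrakk>a \<in> carrier G; b \<in> carrier G\<rbrakk> \<Longrightarrow> a \<otimes> (inv a \<otimes> b) = b"
  by (simp flip: m_assoc)

lemma (in group) bij_betw_mult_left_right:
  assumes "a \<in> carrier G" "b \<in> carrier G"
  shows "bij_betw (\<lambda>x. a \<otimes> x \<otimes> b) (carrier G) (carrier G)"
  by (rule bij_betw_byWitness[where f' = "\<lambda>x. inv a \<otimes> x \<otimes> inv b"])
    (use assms in \<open>auto simp: m_assoc l_inv_cancel r_inv_cancel\<close>)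

lemma (in group) bij_betw_m_inv: "bij_betw (m_inv G) (carrier G) (carrier G)"
  by (rule bij_betw_byWitness[where f' = "m_inv G"]) auto

context near_brace
begin

lemma plus_closed: "\<lbrakk>a \<in> carrier B; b \<in> carrier B\<rbrakk> \<Longrightarrow> a \<oplus> b \<in> carrier B"
  using add.m_closed[of a b] by simp

lemma zero_in_carrier: "\<zero> \<in> carrier B"
  using add.one_closed by simp

lemma uminus_closed: "a \<in> carrier B \<Longrightarrow> \<ominus> a \<in> carrier B"
  using add.inv_closed[of a] by (simp add: a_inv_def)

lemma plus_assoc:
  "\<lbrakk>a \<in> carrier B; b \<in> carrier B; c \<in> carrier B\<rbrakk> \<Longrightarrow> a \<oplus> b \<oplus> c = a \<oplus> (b \<oplus> c)"
  using add.m_assoc[of a b c] by simp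

lemma zero_plus: "a \<in> carrier B \<Longrightarrow> \<zero> \<oplus> a = a"
  using add.l_one[of a] by simp

lemma plus_zero: "a \<in> carrier B \<Longrightarrow> a \<oplus> \<zero> = a"
  using add.r_one[of a] by simp

lemma uminus_plus: "a \<in> carrier B \<Longrightarrow> \<ominus> a \<oplus> a = \<zero>"
  using add.l_inv[of a] by (simp add: a_inv_def)

lemma plus_uminus: "a \<in> carrier B \<Longrightarrow> a \<oplus> \<ominus> a = \<zero>"
  using add.r_inv[of a] by (simp add: a_inv_def)

lemma uminus_uminus: "a \<in> carrier B \<Longrightarrow> \<ominus> (\<ominus> a) = a"
  using add.inv_inv[of a] by (simp add: a_inv_def)

lemma uminus_add: "\<lbrakk>a \<in> carrier B; b \<in> carrier B\<rbrakk> \<Longrightarrow> \<ominus> (a \<oplus> b) = \<ominus> b \<oplus> \<ominus> a"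
  using add.inv_mult_group[of a b] by (simp add: a_inv_def)

lemma uminus_plus_cancel: "\<lbrakk>a \<in> carrier B; b \<in> carrier B\<rbrakk> \<Longrightarrow> \<ominus> a \<oplus> (a \<oplus> b) = b"
  using add.l_inv_cancel[of a b] by (simp add: a_inv_def)

lemma plus_uminus_cancel: "\<lbrakk>a \<in> carrier B; b \<in> carrier B\<rbrakk> \<Longrightarrow> a \<oplus> (\<ominus> a \<oplus> b) = b"
  using add.r_inv_cancel[of a b] by (simp add: a_inv_def)

text \<open>A normal form for words in the possibly nonabelian additive group: negations pushed to
  the letters, sums nested to the right, adjacent inverses cancelled, and no summands ever
  permuted.\<close>

lemmas plus_simps =
  a_minus_def plus_closed zero_in_carrier uminus_closed plus_assoc zero_plus plus_zero
  uminus_plus plus_uminus uminus_uminus uminus_add uminus_plus_cancel plus_uminus_cancel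

text \<open>Distributing \<open>a\<close> over \<open>b \<oplus> \<ominus> b = \<zero>\<close> gives
  an equation containing \<open>a \<otimes> (\<ominus> b)\<close> as its last summand, which is then
  isolated by adding on the left.\<close>

lemma mult_uminus:
  assumes [simp]: "a \<in> carrier B" "b \<in> carrier B"
  shows "a \<otimes> (\<ominus> b) = a \<otimes> \<zero> \<ominus> a \<otimes> b \<oplus> a \<otimes> \<zero>"
proof -
  have "a \<otimes> \<zero> = a \<otimes> b \<ominus> a \<otimes> \<zero> \<oplus> a \<otimes> (\<ominus> b)"
    using near_distrib[of a b "\<ominus> b"] by (simp add: plus_simps)
  then have "a \<otimes> \<zero> \<ominus> a \<otimes> b \<oplus> a \<otimes> \<zero>
      = a \<otimes> \<zero> \<ominus> a \<otimes> b \<oplus> (a \<otimes> b \<ominus> a \<otimes> \<zero> \<oplus> a \<otimes> (\<ominus> b))"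
    by (rule arg_cong)
  then show ?thesis
    by (simp add: plus_simps)
qed

text \<open>Distributing twice puts \<open>\<ominus> a \<otimes> \<zero>\<close> on both sides of
  \<open>a \<otimes> (\<ominus> c)\<close>; the two outer terms of \<open>mult_uminus\<close> cancel
  exactly these.\<close>

lemma mult_minus_plus:
  assumes [simp]: "a \<in> carrier B" "b \<in> carrier B" "c \<in> carrier B" "d \<in> carrier B"
  shows "a \<otimes> (b \<ominus> c \<oplus> d) = a \<otimes> b \<ominus> a \<otimes> c \<oplus> a \<otimes> d"
  by (simp add: plus_simps near_distrib mult_uminus)

text \<open>A two-sided translation for \<circ> followed by one for +. The maps \<sigma>,
  \<open>f\<close> and \<open>g\<close> have this shape, and so does \<tau> up to inverses; an
  absent \<open>p\<close> or \<open>q\<close> is taken to be \<open>\<zero>\<close>.\<close>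

lemma bij_betw_plus_mult:
  assumes "p \<in> carrier B" "q \<in> carrier B" "a \<in> carrier B" "b \<in> carrier B"
  shows "bij_betw (\<lambda>w. p \<oplus> a \<otimes> w \<otimes> b \<oplus> q) (carrier B) (carrier B)"
  using bij_betw_trans[OF bij_betw_mult_left_right[of a b]
      add.bij_betw_mult_left_right[of p q, simplified]] assms
  by (simp add: comp_def)

end

theorem lemma2p26:
  fixes B :: "('a, 'b) ring_scheme" (structure)
    and z1 z2 \<xi> :: 'a
    and \<sigma> \<tau> :: "'a \<Rightarrow> 'a \<Rightarrow> 'a"
    and r :: "'a \<times> 'a \<Rightarrow> 'a \<times> 'a"
  assumes "near_brace B"
    and "z1 \<in> carrier B" "z2 \<in> carrier B" "\<xi> \<in> carrier B"
    and "\<exists>c1\<in>carrier B. \<exists>c2\<in>carrier B.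
      \<forall>a\<in>carrier B. \<forall>b\<in>carrier B. \<forall>c\<in>carrier B.
        (\<forall>z\<in>{z1, z2}. (a \<ominus> b \<oplus> c) \<otimes> z = a \<otimes> z \<ominus> b \<otimes> z \<oplus> c \<otimes> z) \<and>
        a \<otimes> z2 \<otimes> z1 \<ominus> a \<otimes> \<xi> = c1 \<and>
        \<ominus> (a \<otimes> \<xi>) \<oplus> a \<otimes> z1 \<otimes> z2 = c2"
    and "\<And>x y. x \<in> carrier B \<Longrightarrow> y \<in> carrier B \<Longrightarrow>
      \<sigma> x y = x \<otimes> y \<otimes> z1 \<ominus> x \<otimes> \<xi> \<oplus> z2"
    and "\<And>x y. x \<in> carrier B \<Longrightarrow> y \<in> carrier B \<Longrightarrow>
      \<tau> y x = inv (\<sigma> x y) \<otimes> x \<otimes> y"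
    and "\<And>x y. x \<in> carrier B \<Longrightarrow> y \<in> carrier B \<Longrightarrow>
      r (x, y) = (\<sigma> x y, \<tau> y x)"
  shows "p_braiding B r"
proof -
  interpret near_brace B by fact
  note [simp] = assms(2-4) plus_closed zero_in_carrier uminus_closed
  obtain c1 c2 where c [simp]: "c1 \<in> carrier B" "c2 \<in> carrier B"
    and c_spec: "\<forall>a\<in>carrier B. \<forall>b\<in>carrier B. \<forall>c\<in>carrier B.
        (\<forall>z\<in>{z1, z2}. (a \<ominus> b \<oplus> c) \<otimes> z = a \<otimes> z \<ominus> b \<otimes> z \<oplus> c \<otimes> z) \<and>
        a \<otimes> z2 \<otimes> z1 \<ominus> a \<otimes> \<xi> = c1 \<and>
        \<ominus> (a \<otimes> \<xi>) \<oplus> a \<otimes> z1 \<otimes> z2 = c2"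
    using assms(5) by blast
  have z_distrib: "(a \<ominus> b \<oplus> c) \<otimes> z = a \<otimes> z \<ominus> b \<otimes> z \<oplus> c \<otimes> z"
    if "z = z1 \<or> z = z2" "a \<in> carrier B" "b \<in> carrier B" "c \<in> carrier B" for a b c z
    using c_spec that by blast
  have c1_eq: "a \<otimes> z2 \<otimes> z1 \<ominus> a \<otimes> \<xi> = c1"
    and c2_eq: "\<ominus> (a \<otimes> \<xi>) \<oplus> a \<otimes> z1 \<otimes> z2 = c2" if "a \<in> carrier B" for a
    using c_spec that by blast+
  note sigma = assms(6) and tau = assms(7) and r = assms(8)
  have sigma_closed [simp]: "\<sigma> x y \<in> carrier B" if "x \<in> carrier B" "y \<in> carrier B" for x y
    using that by (simp add: sigma a_minus_def)
  have tau_closed [simp]: "\<tau> y x \<in> carrier B" if "x \<in> carrier B" "y \<in> carrier B" for x y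
    using that by (simp add: tau)
  have sigma_tau: "\<sigma> x y \<otimes> \<tau> y x = x \<otimes> y" if "x \<in> carrier B" "y \<in> carrier B" for x y
    using that by (simp add: tau m_assoc r_inv_cancel)
  have r_components: "braid_sigma r x y = \<sigma> x y" "braid_tau r y x = \<tau> y x"
    if "x \<in> carrier B" "y \<in> carrier B" for x y
    using that by (simp_all add: braid_sigma_def braid_tau_def r)
  show ?thesis
  proof
    show "bij_betw r (carrier B \<times> carrier B) (carrier B \<times> carrier B)"
    proof -
      \<comment> \<open>With \<open>u = \<sigma>\<^sub>x(y)\<close> and \<open>u\<circ>v = x\<circ>y\<close>, the definition of \<open>\<sigma>\<close> can be solved for \<open>x\<circ>\<xi>\<close>.\<close>
      define s where "s u v = (z2 \<ominus> u \<oplus> u \<otimes> v \<otimes> z1) \<otimes> inv \<xi>" for u v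
      have s_closed [simp]: "s u v \<in> carrier B" if "u \<in> carrier B" "v \<in> carrier B" for u v
        using that by (simp add: s_def a_minus_def)
      have s_sigma: "s (\<sigma> x y) (\<tau> y x) = x" if "x \<in> carrier B" "y \<in> carrier B" for x y
      proof -
        have "z2 \<ominus> \<sigma> x y \<oplus> x \<otimes> y \<otimes> z1 = x \<otimes> \<xi>"
          using that by (simp add: sigma plus_simps)
        then show ?thesis
          using that by (simp add: s_def sigma_tau m_assoc)
      qed
      have sigma_s: "\<sigma> (s u v) (inv (s u v) \<otimes> (u \<otimes> v)) = u"
        if "u \<in> carrier B" "v \<in> carrier B" for u v
      proof -
        have "s u v \<otimes> \<xi> = z2 \<ominus> u \<oplus> u \<otimes> v \<otimes> z1"
          using that by (simp add: s_def m_assoc a_minus_def)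
        then show ?thesis
          using that by (simp add: sigma r_inv_cancel plus_simps)
      qed
      have tau_s: "\<tau> (inv (s u v) \<otimes> (u \<otimes> v)) (s u v) = v"
        if "u \<in> carrier B" "v \<in> carrier B" for u v
        using that by (simp add: tau sigma_s m_assoc l_inv_cancel r_inv_cancel)
      \<comment> \<open>Once \<open>x = s u v\<close> is recovered, \<open>y\<close> is read off
        from \<open>x \<otimes> y = u \<otimes> v\<close>.\<close>
      show ?thesis
        by (rule bij_betw_byWitness
            [where f' = "\<lambda>(u, v). (s u v, inv (s u v) \<otimes> (u \<otimes> v))"])
          (auto simp: r s_sigma sigma_tau sigma_s tau_s l_inv_cancel)
    qed
  next
    fix x assume [simp]: "x \<in> carrier B"
    have "bij_betw (\<lambda>y. \<zero> \<oplus> x \<otimes> y \<otimes> z1 \<oplus> (\<ominus> (x \<otimes> \<xi>) \<oplus> z2)) (carrier B) (carrier B)"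
      by (intro bij_betw_plus_mult) simp_all
    then show "bij_betw (braid_sigma r x) (carrier B) (carrier B)"
      by (rule bij_betw_cong[THEN iffD1, rotated]) (simp add: r_components sigma plus_simps)
  next
    fix y assume [simp]: "y \<in> carrier B"
    \<comment> \<open>The inverse of \<open>\<tau> y x\<close> is
      \<open>inv (x \<otimes> y) \<otimes> \<sigma> x y\<close>. Distributing the left factor over
      \<sigma> leaves \<open>x\<close> only in the last term, and there only as
      \<open>inv x\<close>, so \<tau> is \<open>?h\<close> conjugated by inversion.\<close>
    let ?h = "\<lambda>w. z1 \<ominus> inv y \<otimes> \<xi> \<oplus> inv y \<otimes> w \<otimes> z2 \<oplus> \<zero>"
    have "bij_betw ?h (carrier B) (carrier B)"
      by (intro bij_betw_plus_mult) (simp_all add: a_minus_def)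
    from bij_betw_trans[OF bij_betw_trans[OF bij_betw_m_inv this] bij_betw_m_inv]
    have bij: "bij_betw (m_inv B \<circ> (?h \<circ> m_inv B)) (carrier B) (carrier B)" .
    have "(m_inv B \<circ> (?h \<circ> m_inv B)) x = braid_tau r y x" if [simp]: "x \<in> carrier B" for x
    proof -
      have "inv (x \<otimes> y) \<otimes> \<sigma> x y
          = inv (x \<otimes> y) \<otimes> (x \<otimes> y \<otimes> z1) \<ominus> inv (x \<otimes> y) \<otimes> (x \<otimes> \<xi>) \<oplus> inv (x \<otimes> y) \<otimes> z2"
        by (simp add: sigma mult_minus_plus)
      also have "\<dots> = ?h (inv x)"
        by (simp add: inv_mult_group m_assoc l_inv_cancel plus_simps)
      finally have "?h (inv x) = inv (\<tau> y x)"
        by (simp add: tau inv_mult_group m_assoc)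
      then show ?thesis
        by (simp add: r_components)
    qed
    then show "bij_betw (braid_tau r y) (carrier B) (carrier B)"
      using bij by (subst bij_betw_cong[symmetric]) auto
  next
    fix x y assume "x \<in> carrier B" "y \<in> carrier B"
    then show "x \<otimes> y = braid_sigma r x y \<otimes> braid_tau r y x"
      by (simp add: r_components sigma_tau)
  next
    \<comment> \<open>Absorbing the bracket into \<open>c1\<close> removes every \<open>x\<close>
      that stands without \<open>y\<close>, so the value depends on \<open>x\<close> and
      \<open>y\<close> only through \<open>a = x \<otimes> y\<close>.\<close>
    let ?f = "\<lambda>a w. a \<otimes> w \<otimes> (z1 \<otimes> z1) \<ominus> a \<otimes> \<xi> \<otimes> z1 \<oplus> c1 \<oplus> z2"
    have bij: "bij_betw (?f a) (carrier B) (carrier B)" if [simp]: "a \<in> carrier B" for a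
      using bij_betw_plus_mult[of \<zero> "\<ominus> (a \<otimes> \<xi> \<otimes> z1) \<oplus> c1 \<oplus> z2" a "z1 \<otimes> z1"]
      by (rule bij_betw_cong[THEN iffD1, rotated -1]) (simp_all add: plus_simps)
    have f: "\<sigma> x (\<sigma> y w) = ?f (x \<otimes> y) w"
      if [simp]: "x \<in> carrier B" "y \<in> carrier B" "w \<in> carrier B" for x y w
    proof -
      have "\<sigma> x (\<sigma> y w) = x \<otimes> (y \<otimes> w \<otimes> z1 \<ominus> y \<otimes> \<xi> \<oplus> z2) \<otimes> z1 \<ominus> x \<otimes> \<xi> \<oplus> z2"
        by (subst sigma[of x "\<sigma> y w"]) (simp_all add: sigma[of y w] a_minus_def)
      also have "\<dots> = x \<otimes> (y \<otimes> w \<otimes> z1) \<otimes> z1 \<ominus> x \<otimes> (y \<otimes> \<xi>) \<otimes> z1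
          \<oplus> x \<otimes> z2 \<otimes> z1 \<ominus> x \<otimes> \<xi> \<oplus> z2"
        by (simp add: mult_minus_plus z_distrib)
      also have "\<dots> = ?f (x \<otimes> y) w"
        by (simp add: m_assoc plus_simps flip: c1_eq[of x])
      finally show ?thesis .
    qed
    have "(id_times_mult B \<circ> on12 r \<circ> on23 r) (x, y, w)
        = (?f (x \<otimes> y) w, inv (?f (x \<otimes> y) w) \<otimes> x \<otimes> y \<otimes> w)"
      if [simp]: "x \<in> carrier B" "y \<in> carrier B" "w \<in> carrier B" for x y w
    proof -
      \<comment> \<open>Unfolding the left factor brings \<open>\<sigma> y w\<close> next to
        \<open>\<tau> w y\<close>, and their product is \<open>y \<otimes> w\<close>.\<close>
      have "\<tau> (\<sigma> y w) x \<otimes> \<tau> w y = inv (\<sigma> x (\<sigma> y w)) \<otimes> x \<otimes> y \<otimes> w"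
        by (simp add: tau[of x "\<sigma> y w"] m_assoc sigma_tau)
      then show ?thesis
        by (simp add: id_times_mult_def on12_def on23_def r f)
    qed
    with bij show "\<exists>f. (\<forall>x\<in>carrier B. bij_betw (f x) (carrier B) (carrier B)) \<and>
      (\<forall>x\<in>carrier B. \<forall>y\<in>carrier B. \<forall>w\<in>carrier B.
        (id_times_mult B \<circ> on12 r \<circ> on23 r) (x, y, w)
          = (f (x \<otimes> y) w, inv (f (x \<otimes> y) w) \<otimes> x \<otimes> y \<otimes> w))"
      by (intro exI[of _ ?f]) blast
  next
    \<comment> \<open>Here \<open>c2\<close>, taken at \<open>a = x \<otimes> y\<close>, absorbs
      every \<open>y\<close> that stands without \<open>w\<close>, so only
      \<open>u = y \<otimes> w\<close> remains.\<close>
    let ?g = "\<lambda>x u. x \<otimes> u \<otimes> z1 \<oplus> c2 \<ominus> x \<otimes> \<xi> \<otimes> z2 \<oplus> z2 \<otimes> z2"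
    have bij: "bij_betw (?g x) (carrier B) (carrier B)" if [simp]: "x \<in> carrier B" for x
      using bij_betw_plus_mult[of \<zero> "c2 \<ominus> x \<otimes> \<xi> \<otimes> z2 \<oplus> z2 \<otimes> z2" x z1]
      by (rule bij_betw_cong[THEN iffD1, rotated -1]) (simp_all add: plus_simps)
    have g: "\<sigma> x y \<otimes> \<sigma> (\<tau> y x) w = ?g x (y \<otimes> w)"
      if [simp]: "x \<in> carrier B" "y \<in> carrier B" "w \<in> carrier B" for x y w
    proof -
      \<comment> \<open>The factor \<open>\<sigma> x y\<close> is kept folded while it is
        distributed from the left: in the first two terms it meets \<open>\<tau> y x\<close> and
        gives \<open>x \<otimes> y\<close>. Only the third term needs right distributivity, by
        \<open>z2\<close>.\<close>
      have "\<sigma> x y \<otimes> \<sigma> (\<tau> y x) w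
          = \<sigma> x y \<otimes> (\<tau> y x \<otimes> w \<otimes> z1) \<ominus> \<sigma> x y \<otimes> (\<tau> y x \<otimes> \<xi>) \<oplus> \<sigma> x y \<otimes> z2"
        by (simp add: sigma[of "\<tau> y x" w] mult_minus_plus)
      also have "\<dots> = x \<otimes> y \<otimes> w \<otimes> z1 \<ominus> x \<otimes> y \<otimes> \<xi> \<oplus> \<sigma> x y \<otimes> z2"
        by (simp add: sigma_tau flip: m_assoc)
      also have "\<sigma> x y \<otimes> z2 = x \<otimes> y \<otimes> z1 \<otimes> z2 \<ominus> x \<otimes> \<xi> \<otimes> z2 \<oplus> z2 \<otimes> z2"
        by (simp add: sigma z_distrib)
      finally show ?thesis
        by (simp add: m_assoc plus_simps flip: c2_eq[of "x \<otimes> y"])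
    qed
    have "(mult_times_id B \<circ> on23 r \<circ> on12 r) (x, y, w)
        = (?g x (y \<otimes> w), inv (?g x (y \<otimes> w)) \<otimes> x \<otimes> y \<otimes> w)"
      if [simp]: "x \<in> carrier B" "y \<in> carrier B" "w \<in> carrier B" for x y w
    proof -
      \<comment> \<open>A cancelling pair of \<open>\<sigma> x y\<close> and its inverse is inserted
        in front of \<open>\<tau> y x\<close>, so that the product \<open>x \<otimes> y\<close>
        appears.\<close>
      have "\<tau> w (\<tau> y x)
          = inv (\<sigma> x y \<otimes> \<sigma> (\<tau> y x) w) \<otimes> (\<sigma> x y \<otimes> \<tau> y x) \<otimes> w"
        by (simp add: tau[of "\<tau> y x" w] inv_mult_group m_assoc l_inv_cancel)
      also have "\<dots> = inv (\<sigma> x y \<otimes> \<sigma> (\<tau> y x) w) \<otimes> x \<otimes> y \<otimes> w"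
        by (simp add: sigma_tau m_assoc)
      finally have "\<tau> w (\<tau> y x) = inv (\<sigma> x y \<otimes> \<sigma> (\<tau> y x) w) \<otimes> x \<otimes> y \<otimes> w" .
      then show ?thesis
        by (simp add: mult_times_id_def on12_def on23_def r g)
    qed
    with bij show "\<exists>g. (\<forall>x\<in>carrier B. bij_betw (g x) (carrier B) (carrier B)) \<and>
      (\<forall>x\<in>carrier B. \<forall>y\<in>carrier B. \<forall>w\<in>carrier B.
        (mult_times_id B \<circ> on23 r \<circ> on12 r) (x, y, w)
          = (g x (y \<otimes> w), inv (g x (y \<otimes> w)) \<otimes> x \<otimes> y \<otimes> w))"
      by (intro exI[of _ ?g]) blast
  qed
qed

end
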